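(* For a non-empty dGEC $\mathfrak G=(V,\kappa)$ the following conditions are equivalent: (i) $\mathfrak G$ is an AB-HO dGEC in which all edges outcoming from a single vertex have different colors; (ii) $\mathfrak G$ is an AB-HO dGEC in which all edges incoming to a single vertex have different colors; (iii) $\mathfrak G$ is isomorphic (as a dGEC) to a group equipped with the left dGEC-structure.
   Context: A directed GEC (dGEC) is a pair $\mathfrak G=(V,\kappa)$ where $V$ is a set (of vertices) and $\kappa$ is a function defined on $V\times V$ such that for all $x,y,z\in V$: $\kappa(x,y)=\kappa(z,z)\iff x=y$. For $x\neq y$, $\kappa(x,y)$ is the color of the directed edge $(x,y)$, which is outcoming from $x$ and incoming to $y$. A partial morphism from $(V,\kappa)$ into $(W,\lambda)$ is a function $f\colon A\to W$ with $A\subset V$ and $\kappa(a,b)=\lambda(f(a),f(b))$ for all $a,b\in A$; an isomorphism is a bijective one with $A=V$; an automorphism is a self-isomorphism. A dGEC is absolutely homogeneous (AB-HO) if every partial morphism from it into itself extends to an automorphism. The left dGEC-structure of a group $(G,\cdot)$ is the edge-coloring $L_G\colon G\times G\to G$, $L_G(a,b)=a^{-1}b$; thus the group with this structure is the dGEC $(G,L_G)$. *)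

theory Defs
  imports "HOL-Algebra.Group"
begin

text \<open>Only the values of \<open>color\<close> on pairs of vertices are relevant: every notion below is
  relativised to \<open>verts\<close>, so that \<open>color\<close> stands for a function on \<open>verts \<times> verts\<close>.\<close>

record ('v, 'c) edge_colored =
  verts :: "'v set"
  color :: "'v \<Rightarrow> 'v \<Rightarrow> 'c"

definition dGEC :: "('v, 'c) edge_colored \<Rightarrow> bool" where
  "dGEC X \<longleftrightarrow>
     (\<forall>x\<in>verts X. \<forall>y\<in>verts X. \<forall>z\<in>verts X. color X x y = color X z z \<longleftrightarrow> x = y)"

text \<open>Colors are preserved on the nose, so source and target share the type of colors.\<close>

definition partial_morphism ::
  "('v, 'c) edge_colored \<Rightarrow> ('w, 'c) edge_colored \<Rightarrow> 'v set \<Rightarrow> ('v \<Rightarrow> 'w) \<Rightarrow> bool" where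
  "partial_morphism X Y A f \<longleftrightarrow>
     A \<subseteq> verts X \<and> f \<in> A \<rightarrow> verts Y \<and>
     (\<forall>a\<in>A. \<forall>b\<in>A. color X a b = color Y (f a) (f b))"

definition dGEC_iso ::
  "('v, 'c) edge_colored \<Rightarrow> ('w, 'c) edge_colored \<Rightarrow> ('v \<Rightarrow> 'w) \<Rightarrow> bool" where
  "dGEC_iso X Y f \<longleftrightarrow> partial_morphism X Y (verts X) f \<and> bij_betw f (verts X) (verts Y)"

definition isomorphic_dGEC ::
  "('v, 'c) edge_colored \<Rightarrow> ('w, 'c) edge_colored \<Rightarrow> bool" where
  "isomorphic_dGEC X Y \<longleftrightarrow> (\<exists>f. dGEC_iso X Y f)"

definition dGEC_automorphism :: "('v, 'c) edge_colored \<Rightarrow> ('v \<Rightarrow> 'v) \<Rightarrow> bool" where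
  "dGEC_automorphism X f \<longleftrightarrow> dGEC_iso X X f"

definition absolutely_homogeneous :: "('v, 'c) edge_colored \<Rightarrow> bool" where
  "absolutely_homogeneous X \<longleftrightarrow>
     (\<forall>A f. partial_morphism X X A f \<longrightarrow>
        (\<exists>g. dGEC_automorphism X g \<and> (\<forall>a\<in>A. g a = f a)))"

text \<open>A pair \<open>(x, y)\<close> is an edge only if \<open>x \<noteq> y\<close>; loops are excluded in the next two
  definitions.\<close>

definition distinct_out_colors :: "('v, 'c) edge_colored \<Rightarrow> bool" where
  "distinct_out_colors X \<longleftrightarrow>
     (\<forall>x\<in>verts X. inj_on (\<lambda>y. color X x y) (verts X - {x}))"

definition distinct_in_colors :: "('v, 'c) edge_colored \<Rightarrow> bool" where
  "distinct_in_colors X \<longleftrightarrow>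
     (\<forall>x\<in>verts X. inj_on (\<lambda>y. color X y x) (verts X - {x}))"

text \<open>The colors are the group elements themselves; hence a group whose left structure is
  isomorphic to \<open>X\<close> necessarily lives in the type of colors of \<open>X\<close>.\<close>

definition left_dGEC :: "('g, 'm) monoid_scheme \<Rightarrow> ('g, 'g) edge_colored" where
  "left_dGEC G = \<lparr>verts = carrier G, color = (\<lambda>a b. inv\<^bsub>G\<^esub> a \<otimes>\<^bsub>G\<^esub> b)\<rparr>"

lemma dGEC_left_dGEC:
  assumes "group G"
  shows "dGEC (left_dGEC G)"
proof -
  have "inv\<^bsub>G\<^esub> x \<otimes>\<^bsub>G\<^esub> y = \<one>\<^bsub>G\<^esub> \<longleftrightarrow> x = y"
    if "x \<in> carrier G" "y \<in> carrier G" for x y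
    using that assms by (metis group.inv_closed group.inv_equality group.inv_inv group.l_inv)
  then show ?thesis
    using assms by (simp add: dGEC_def left_dGEC_def group.l_inv)
qed

end

theory Submission
  imports Defs
begin

text \<open>
  The automorphism group of an absolutely homogeneous dGEC is transitive on vertices, since all
  loops have the same color and hence every map between two singletons is a partial morphism. If
  edges leaving a vertex have different colors, an
  automorphism is determined by its value at one vertex, so that the action is simply transitive.
  Then, if two edges entering the same vertex have equal colors, an automorphism that maps the
  source of one to the source of the other must fix the common target, hence to be the identity; this turns the
  condition on outgoing edges into the one on incoming edges, and the dual argument turns it back
  (lemmas \<open>distinct_out_imp_in\<close> and \<open>distinct_in_imp_out\<close>).

  A simply transitive group is a copy of the vertex set, but it can be seen directly
  in the colors: composing edges by \<open>\<kappa>(x, y) \<cdot> \<kappa>(y, z) = \<kappa>(x, z)\<close> is a well-defined operation,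
  because the colors of a path of length two determine the path up to an automorphism. The colors
  form a group in this way (lemma \<open>group_color_group\<close>), and \<open>x \<mapsto> \<kappa>(e, x)\<close> is an isomorphism onto
  it for each vertex \<open>e\<close>, because \<open>\<kappa>(e, a)\<inverse> \<cdot> \<kappa>(e, b) = \<kappa>(a, e) \<cdot> \<kappa>(e, b) = \<kappa>(a, b)\<close>.

  Conversely, a partial morphism of the left structure of a group preserves \<open>a\<inverse> b\<close>, so that it
  coincides on its domain with a left translation, which is an automorphism. Cancellation gives the conditions
  on colors.
\<close>

section \<open>Isomorphisms\<close>

lemma dGEC_isoI:
  assumes "bij_betw f (verts X) (verts Y)"
    and "\<And>a b. a \<in> verts X \<Longrightarrow> b \<in> verts X \<Longrightarrow> color Y (f a) (f b) = color X a b"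
  shows "dGEC_iso X Y f"
  using assms by (auto simp: dGEC_iso_def partial_morphism_def dest: bij_betwE)

lemma dGEC_iso_bij: "dGEC_iso X Y f \<Longrightarrow> bij_betw f (verts X) (verts Y)"
  by (simp add: dGEC_iso_def)

lemma dGEC_iso_closed: "dGEC_iso X Y f \<Longrightarrow> a \<in> verts X \<Longrightarrow> f a \<in> verts Y"
  using bij_betwE dGEC_iso_bij by blast

lemma dGEC_iso_color:
  "dGEC_iso X Y f \<Longrightarrow> a \<in> verts X \<Longrightarrow> b \<in> verts X \<Longrightarrow> color Y (f a) (f b) = color X a b"
  by (simp add: dGEC_iso_def partial_morphism_def)

lemma dGEC_iso_comp:
  assumes "dGEC_iso X Y f" "dGEC_iso Y Z g"
  shows "dGEC_iso X Z (g \<circ> f)"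
  using assms
  by (intro dGEC_isoI) (auto intro: bij_betw_trans dGEC_iso_bij simp: dGEC_iso_color dGEC_iso_closed)

lemma dGEC_iso_inv_into:
  assumes f: "dGEC_iso X Y f"
  shows "dGEC_iso Y X (inv_into (verts X) f)"
proof (rule dGEC_isoI)
  note bij = dGEC_iso_bij[OF f]
  show "bij_betw (inv_into (verts X) f) (verts Y) (verts X)"
    by (rule bij_betw_inv_into[OF bij])
  fix a b assume "a \<in> verts Y" "b \<in> verts Y"
  moreover define a' b' where "a' = inv_into (verts X) f a" and "b' = inv_into (verts X) f b"
  ultimately have "a' \<in> verts X" "b' \<in> verts X" "f a' = a" "f b' = b"
    using bij by (auto simp: bij_betw_inv_into_right bij_betwE[OF bij_betw_inv_into[OF bij]])
  then show "color X (inv_into (verts X) f a) (inv_into (verts X) f b) = color Y a b"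
    using dGEC_iso_color[OF f, of a' b'] by (simp add: a'_def b'_def)
qed

text \<open>Conjugation by the isomorphism carries partial morphisms and automorphisms of one dGEC
  to those of the other.\<close>

lemma absolutely_homogeneous_iso:
  assumes f: "dGEC_iso X Y f" and Y: "absolutely_homogeneous Y"
  shows "absolutely_homogeneous X"
  unfolding absolutely_homogeneous_def
proof (intro allI impI)
  fix A h assume h: "partial_morphism X X A h"
  let ?f' = "inv_into (verts X) f"
  have inv: "?f' (f a) = a" if "a \<in> verts X" for a
    using that bij_betw_inv_into_left[OF dGEC_iso_bij[OF f]] by simp
  have A: "A \<subseteq> verts X" and hA: "\<And>a. a \<in> A \<Longrightarrow> h a \<in> verts X"
    using h by (auto simp: partial_morphism_def)
  have "partial_morphism Y Y (f ` A) (f \<circ> h \<circ> ?f')"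
    unfolding partial_morphism_def
  proof (intro conjI ballI)
    show "f ` A \<subseteq> verts Y" using A dGEC_iso_closed[OF f] by auto
    show "f \<circ> h \<circ> ?f' \<in> f ` A \<rightarrow> verts Y"
      using A hA dGEC_iso_closed[OF f] inv by (auto simp: subset_iff)
    fix a b assume "a \<in> f ` A" "b \<in> f ` A"
    then obtain a' b' where "a' \<in> A" "b' \<in> A" "a = f a'" "b = f b'" by auto
    then show "color Y a b = color Y ((f \<circ> h \<circ> ?f') a) ((f \<circ> h \<circ> ?f') b)"
      using A hA inv h dGEC_iso_color[OF f] by (auto simp: subset_iff partial_morphism_def)
  qed
  with Y have "\<exists>g. dGEC_automorphism Y g \<and> (\<forall>a\<in>f ` A. g a = (f \<circ> h \<circ> ?f') a)"
    unfolding absolutely_homogeneous_def by (elim allE impE)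
  then obtain g where g: "dGEC_iso Y Y g" "\<forall>a\<in>f ` A. g a = (f \<circ> h \<circ> ?f') a"
    by (auto simp: dGEC_automorphism_def)
  have "dGEC_automorphism X (?f' \<circ> (g \<circ> f))"
    unfolding dGEC_automorphism_def
    using dGEC_iso_comp[OF dGEC_iso_comp[OF f g(1)] dGEC_iso_inv_into[OF f]] .
  moreover have "(?f' \<circ> (g \<circ> f)) a = h a" if "a \<in> A" for a
    using that A hA g(2) inv by (auto simp: subset_iff)
  ultimately show "\<exists>g. dGEC_automorphism X g \<and> (\<forall>a\<in>A. g a = h a)" by blast
qed

lemma distinct_out_colors_iso:
  assumes f: "dGEC_iso X Y f" and Y: "distinct_out_colors Y"
  shows "distinct_out_colors X"
proof -
  have inj: "\<And>a b. a \<in> verts X \<Longrightarrow> b \<in> verts X \<Longrightarrow> f a = f b \<longleftrightarrow> a = b"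
    using dGEC_iso_bij[OF f] by (metis bij_betw_def inj_on_eq_iff)
  show ?thesis
    unfolding distinct_out_colors_def
  proof (intro ballI inj_onI)
    fix x y z assume xyz: "x \<in> verts X" "y \<in> verts X - {x}" "z \<in> verts X - {x}"
      and "color X x y = color X x z"
    then have "color Y (f x) (f y) = color Y (f x) (f z)"
      using dGEC_iso_color[OF f] by simp
    moreover have "f x \<in> verts Y" "f y \<in> verts Y - {f x}" "f z \<in> verts Y - {f x}"
      using xyz dGEC_iso_closed[OF f] inj by auto
    ultimately have "f y = f z"
      using Y unfolding distinct_out_colors_def by (blast dest: inj_onD)
    then show "y = z" using xyz inj by simp
  qed
qed

section \<open>Colors at a vertex of an absolutely homogeneous dGEC\<close>

lemma color_loop_eq:
  "dGEC X \<Longrightarrow> x \<in> verts X \<Longrightarrow> y \<in> verts X \<Longrightarrow> color X x x = color X y y"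
  by (auto simp: dGEC_def)

text \<open>A loop never shares its color with an edge, so that injectivity on edges extends to
  all pairs with a given source or target.\<close>

lemma distinct_out_colorsD:
  assumes X: "dGEC X" "distinct_out_colors X" and V: "x \<in> verts X" "y \<in> verts X" "z \<in> verts X"
    and eq: "color X x y = color X x z"
  shows "y = z"
proof (cases "y = x \<or> z = x")
  case True
  note loop = X(1)[unfolded dGEC_def, rule_format]
  from True show ?thesis using loop[of x y x] loop[of x z x] V eq by auto
next
  case False
  then show ?thesis
    using V eq inj_onD[OF X(2)[unfolded distinct_out_colors_def, rule_format, OF V(1)]] by simp
qed

lemma distinct_in_colorsD:
  assumes X: "dGEC X" "distinct_in_colors X" and V: "x \<in> verts X" "y \<in> verts X" "z \<in> verts X"
    and eq: "color X y x = color X z x"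
  shows "y = z"
proof (cases "y = x \<or> z = x")
  case True
  note loop = X(1)[unfolded dGEC_def, rule_format]
  from True show ?thesis using loop[of y x x] loop[of z x x] V eq by auto
next
  case False
  then show ?thesis
    using V eq inj_onD[OF X(2)[unfolded distinct_in_colors_def, rule_format, OF V(1)]] by simp
qed

text \<open>All loops have one color, so that the map from one vertex to another is a partial
  morphism and extends.\<close>

lemma automorphism_transitive:
  assumes X: "dGEC X" "absolutely_homogeneous X" and "x \<in> verts X" "y \<in> verts X"
  obtains g where "dGEC_iso X X g" "g x = y"
proof -
  have "partial_morphism X X {x} (\<lambda>_. y)"
    using assms color_loop_eq[of X x y] by (auto simp: partial_morphism_def)
  with X(2) have "\<exists>g. dGEC_automorphism X g \<and> (\<forall>a\<in>{x}. g a = y)"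
    unfolding absolutely_homogeneous_def by (elim allE impE)
  then show thesis
    using that by (auto simp: dGEC_automorphism_def)
qed

text \<open>If \<open>\<kappa>(y, x) = \<kappa>(z, x)\<close>, an automorphism that maps \<open>y\<close> to \<open>z\<close> fixes \<open>x\<close>, because
  \<open>x\<close> and its image are reached from \<open>z\<close> by the same color. The second lemma is the same argument
  with all edges reversed.\<close>

lemma distinct_out_imp_in:
  assumes X: "dGEC X" "absolutely_homogeneous X" and out: "distinct_out_colors X"
  shows "distinct_in_colors X"
  unfolding distinct_in_colors_def
proof (intro ballI inj_onI)
  fix x y z assume "x \<in> verts X" "y \<in> verts X - {x}" "z \<in> verts X - {x}"
    and eq: "color X y x = color X z x"
  then have V: "x \<in> verts X" "y \<in> verts X" "z \<in> verts X" by auto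
  obtain g where g: "dGEC_iso X X g" "g y = z"
    using automorphism_transitive[OF X V(2,3)] .
  have gV: "g x \<in> verts X" using dGEC_iso_closed[OF g(1)] V by simp
  have "color X z (g x) = color X z x"
    using dGEC_iso_color[OF g(1) V(2,1)] g(2) eq by simp
  then have fix_x: "g x = x"
    using distinct_out_colorsD[OF X(1) out V(3) gV V(1)] by simp
  \<comment> \<open>As \<open>g\<close> fixes \<open>x\<close>, it preserves the color of each edge that leaves \<open>x\<close>.\<close>
  have "color X x z = color X x y"
    using dGEC_iso_color[OF g(1) V(1,2)] g(2) fix_x by simp
  then show "y = z"
    using distinct_out_colorsD[OF X(1) out V(1,3,2)] by simp
qed

lemma distinct_in_imp_out:
  assumes X: "dGEC X" "absolutely_homogeneous X" and ins: "distinct_in_colors X"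
  shows "distinct_out_colors X"
  unfolding distinct_out_colors_def
proof (intro ballI inj_onI)
  fix x y z assume "x \<in> verts X" "y \<in> verts X - {x}" "z \<in> verts X - {x}"
    and eq: "color X x y = color X x z"
  then have V: "x \<in> verts X" "y \<in> verts X" "z \<in> verts X" by auto
  obtain g where g: "dGEC_iso X X g" "g y = z"
    using automorphism_transitive[OF X V(2,3)] .
  have gV: "g x \<in> verts X" using dGEC_iso_closed[OF g(1)] V by simp
  have "color X (g x) z = color X x z"
    using dGEC_iso_color[OF g(1) V(1,2)] g(2) eq by simp
  then have fix_x: "g x = x"
    using distinct_in_colorsD[OF X(1) ins V(3) gV V(1)] by simp
  have "color X z x = color X y x"
    using dGEC_iso_color[OF g(1) V(2,1)] g(2) fix_x by simp
  then show "y = z"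
    using distinct_in_colorsD[OF X(1) ins V(1,3,2)] by simp
qed

section \<open>The group of colors\<close>

text \<open>The product of two colors is the color of the edge that closes a path with these colors.
  Paths, rather than chosen automorphisms or a base vertex, define it, so that associativity is
  read off a path of length three; that the closing color is unique rests on
  \<open>path_color_unique\<close>.\<close>

definition color_group :: "('v, 'c) edge_colored \<Rightarrow> 'c monoid" where
  "color_group X =
     \<lparr>carrier = {color X x y |x y. x \<in> verts X \<and> y \<in> verts X},
      monoid.mult = (\<lambda>c d. THE k. \<exists>x\<in>verts X. \<exists>y\<in>verts X. \<exists>z\<in>verts X.
        c = color X x y \<and> d = color X y z \<and> k = color X x z),
      one = (THE k. \<exists>x\<in>verts X. k = color X x x)\<rparr>"

lemma ex_out_edge:
  assumes X: "dGEC X" "absolutely_homogeneous X" and V: "x \<in> verts X" "y \<in> verts X" "x' \<in> verts X"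
  obtains y' where "y' \<in> verts X" "color X x' y' = color X x y"
proof -
  obtain g where g: "dGEC_iso X X g" "g x = x'"
    using automorphism_transitive[OF X V(1,3)] .
  then show thesis
    using that[of "g y"] dGEC_iso_color[OF g(1) V(1,2)] dGEC_iso_closed[OF g(1) V(2)] by simp
qed

text \<open>The automorphism that matches the initial vertices of two paths with the same colors
  must match the paths, because no other edge leaving a vertex has the given color.\<close>

lemma path_color_unique:
  assumes X: "dGEC X" "absolutely_homogeneous X" "distinct_out_colors X"
    and V: "x \<in> verts X" "y \<in> verts X" "z \<in> verts X"
    and V': "x' \<in> verts X" "y' \<in> verts X" "z' \<in> verts X"
    and eq: "color X x y = color X x' y'" "color X y z = color X y' z'"
  shows "color X x z = color X x' z'"
proof -
  obtain g where g: "dGEC_iso X X g" "g x = x'"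
    using automorphism_transitive[OF X(1,2) V(1) V'(1)] .
  note gV = dGEC_iso_closed[OF g(1)] and gc = dGEC_iso_color[OF g(1)]
  have "g y = y'"
    using distinct_out_colorsD[OF X(1,3) V'(1) gV[OF V(2)] V'(2)] gc[OF V(1,2)] g(2) eq(1) by simp
  then have "g z = z'"
    using distinct_out_colorsD[OF X(1,3) V'(2) gV[OF V(3)] V'(3)] gc[OF V(2,3)] eq(2) by simp
  then show ?thesis
    using gc[OF V(1,3)] g(2) by simp
qed

lemma color_group_mult:
  assumes X: "dGEC X" "absolutely_homogeneous X" "distinct_out_colors X"
    and V: "x \<in> verts X" "y \<in> verts X" "z \<in> verts X"
  shows "color X x y \<otimes>\<^bsub>color_group X\<^esub> color X y z = color X x z"
  unfolding color_group_def monoid.simps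
proof (rule the_equality)
  fix k
  assume "\<exists>u\<in>verts X. \<exists>v\<in>verts X. \<exists>w\<in>verts X.
    color X x y = color X u v \<and> color X y z = color X v w \<and> k = color X u w"
  then show "k = color X x z"
    by (elim bexE conjE) (simp add: path_color_unique[OF X V])
qed (use V in blast)

lemma color_group_one:
  assumes X: "dGEC X" and x: "x \<in> verts X"
  shows "\<one>\<^bsub>color_group X\<^esub> = color X x x"
  unfolding color_group_def monoid.simps
proof (rule the_equality)
  fix k assume "\<exists>y\<in>verts X. k = color X y y"
  then show "k = color X x x" using color_loop_eq[OF X _ x] by blast
qed (use x in blast)

lemma color_in_color_group:
  "x \<in> verts X \<Longrightarrow> y \<in> verts X \<Longrightarrow> color X x y \<in> carrier (color_group X)"
  by (auto simp: color_group_def)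

text \<open>The color of an edge occurs at each vertex, so that any sequence of colors is realized
  along a path that starts there.\<close>

lemma color_groupE:
  assumes X: "dGEC X" "absolutely_homogeneous X"
    and c: "c \<in> carrier (color_group X)" and e: "e \<in> verts X"
  obtains y where "y \<in> verts X" "c = color X e y"
proof -
  obtain u v where "u \<in> verts X" "v \<in> verts X" "c = color X u v"
    using c by (auto simp: color_group_def)
  then show thesis
    using ex_out_edge[OF X _ _ e] that by metis
qed

lemma group_color_group:
  assumes X: "dGEC X" "absolutely_homogeneous X" "distinct_out_colors X" and e: "e \<in> verts X"
  shows "group (color_group X)"
proof (rule groupI)
  note E = color_groupE[OF X(1,2)] and M = color_group_mult[OF X]
  show "\<one>\<^bsub>color_group X\<^esub> \<in> carrier (color_group X)"
    using color_in_color_group[OF e e] by (simp add: color_group_one[OF X(1) e])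
  fix c assume c: "c \<in> carrier (color_group X)"
  obtain y where y: "y \<in> verts X" "c = color X e y" using E[OF c e] .
  show "\<one>\<^bsub>color_group X\<^esub> \<otimes>\<^bsub>color_group X\<^esub> c = c"
    using M[OF e e y(1)] y(2) by (simp add: color_group_one[OF X(1) e])
  have "color X y e \<otimes>\<^bsub>color_group X\<^esub> c = \<one>\<^bsub>color_group X\<^esub>"
    using M[OF y(1) e y(1)] y(2) by (simp add: color_group_one[OF X(1) y(1)])
  then show "\<exists>b\<in>carrier (color_group X). b \<otimes>\<^bsub>color_group X\<^esub> c = \<one>\<^bsub>color_group X\<^esub>"
    using color_in_color_group[OF y(1) e] by blast
  fix d assume d: "d \<in> carrier (color_group X)"
  obtain z where z: "z \<in> verts X" "d = color X y z" using E[OF d y(1)] .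
  show "c \<otimes>\<^bsub>color_group X\<^esub> d \<in> carrier (color_group X)"
    using M[OF e y(1) z(1)] y z e color_in_color_group by simp
  fix k assume k: "k \<in> carrier (color_group X)"
  obtain w where w: "w \<in> verts X" "k = color X z w" using E[OF k z(1)] .
  show "c \<otimes>\<^bsub>color_group X\<^esub> d \<otimes>\<^bsub>color_group X\<^esub> k = c \<otimes>\<^bsub>color_group X\<^esub> (d \<otimes>\<^bsub>color_group X\<^esub> k)"
    using M y z w e by simp
qed

lemma dGEC_iso_color_group:
  assumes X: "dGEC X" "absolutely_homogeneous X" "distinct_out_colors X" and e: "e \<in> verts X"
  shows "dGEC_iso X (left_dGEC (color_group X)) (color X e)"
proof (rule dGEC_isoI)
  have "inj_on (color X e) (verts X)"
    by (rule inj_onI) (rule distinct_out_colorsD[OF X(1,3) e])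
  moreover have "color X e ` verts X = carrier (color_group X)"
    using color_in_color_group[OF e] color_groupE[OF X(1,2) _ e] by blast
  ultimately show "bij_betw (color X e) (verts X) (verts (left_dGEC (color_group X)))"
    by (simp add: bij_betw_def left_dGEC_def)
  fix a b assume a: "a \<in> verts X" and b: "b \<in> verts X"
  interpret group "color_group X" by (rule group_color_group[OF X e])
  have "color X a e \<otimes>\<^bsub>color_group X\<^esub> color X e a = \<one>\<^bsub>color_group X\<^esub>"
    using color_group_mult[OF X a e a] by (simp add: color_group_one[OF X(1) a])
  then have "inv\<^bsub>color_group X\<^esub> (color X e a) = color X a e"
    using a e by (intro inv_equality color_in_color_group)
  then show "color (left_dGEC (color_group X)) (color X e a) (color X e b) = color X a b"
    using color_group_mult[OF X a e b] by (simp add: left_dGEC_def)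
qed

section \<open>The left structure of a group\<close>

lemma distinct_out_colors_left_dGEC:
  assumes "group G"
  shows "distinct_out_colors (left_dGEC G)"
proof -
  interpret group G by fact
  show ?thesis
    by (auto simp: distinct_out_colors_def left_dGEC_def inj_on_def)
qed

lemma left_translation_automorphism:
  assumes "group G" and t: "t \<in> carrier G"
  shows "dGEC_automorphism (left_dGEC G) (\<lambda>a. t \<otimes>\<^bsub>G\<^esub> a)"
  unfolding dGEC_automorphism_def
proof (rule dGEC_isoI)
  interpret group G by fact
  show "bij_betw (\<lambda>a. t \<otimes>\<^bsub>G\<^esub> a) (verts (left_dGEC G)) (verts (left_dGEC G))"
    using t by (intro bij_betw_byWitness[where f' = "\<lambda>a. inv\<^bsub>G\<^esub> t \<otimes>\<^bsub>G\<^esub> a"])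
      (auto simp: left_dGEC_def m_assoc[symmetric])
  fix a b assume "a \<in> verts (left_dGEC G)" "b \<in> verts (left_dGEC G)"
  then have a: "a \<in> carrier G" and b: "b \<in> carrier G" by (auto simp: left_dGEC_def)
  have "inv\<^bsub>G\<^esub> (t \<otimes>\<^bsub>G\<^esub> a) \<otimes>\<^bsub>G\<^esub> (t \<otimes>\<^bsub>G\<^esub> b) = inv\<^bsub>G\<^esub> a \<otimes>\<^bsub>G\<^esub> (inv\<^bsub>G\<^esub> t \<otimes>\<^bsub>G\<^esub> (t \<otimes>\<^bsub>G\<^esub> b))"
    using t a b by (simp add: inv_mult_group m_assoc)
  also have "\<dots> = inv\<^bsub>G\<^esub> a \<otimes>\<^bsub>G\<^esub> b"
    using t b by (simp add: m_assoc[symmetric])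
  finally show "color (left_dGEC G) (t \<otimes>\<^bsub>G\<^esub> a) (t \<otimes>\<^bsub>G\<^esub> b) = color (left_dGEC G) a b"
    by (simp add: left_dGEC_def)
qed

text \<open>A partial morphism \<open>f\<close> preserves \<open>s\<inverse> a\<close> for a fixed \<open>s\<close> in its domain, so that
  \<open>f a = f s s\<inverse> a\<close>: it is the left translation by \<open>f s s\<inverse>\<close>.\<close>

lemma absolutely_homogeneous_left_dGEC:
  assumes "group G"
  shows "absolutely_homogeneous (left_dGEC G)"
  unfolding absolutely_homogeneous_def
proof (intro allI impI)
  interpret group G by fact
  fix A f assume "partial_morphism (left_dGEC G) (left_dGEC G) A f"
  then have A: "\<And>a. a \<in> A \<Longrightarrow> a \<in> carrier G" and fA: "\<And>a. a \<in> A \<Longrightarrow> f a \<in> carrier G"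
    and eq: "\<And>a b. a \<in> A \<Longrightarrow> b \<in> A \<Longrightarrow> inv\<^bsub>G\<^esub> a \<otimes>\<^bsub>G\<^esub> b = inv\<^bsub>G\<^esub> (f a) \<otimes>\<^bsub>G\<^esub> f b"
    by (auto simp: partial_morphism_def left_dGEC_def)
  show "\<exists>g. dGEC_automorphism (left_dGEC G) g \<and> (\<forall>a\<in>A. g a = f a)"
  proof (cases "A = {}")
    case True
    then show ?thesis
      using left_translation_automorphism[OF assms one_closed] by blast
  next
    case False
    then obtain s where s: "s \<in> A" by blast
    define t where "t = f s \<otimes>\<^bsub>G\<^esub> inv\<^bsub>G\<^esub> s"
    have t: "t \<in> carrier G" using A[OF s] fA[OF s] by (simp add: t_def)
    have "t \<otimes>\<^bsub>G\<^esub> a = f a" if a: "a \<in> A" for a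
    proof -
      have "t \<otimes>\<^bsub>G\<^esub> a = f s \<otimes>\<^bsub>G\<^esub> (inv\<^bsub>G\<^esub> (f s) \<otimes>\<^bsub>G\<^esub> f a)"
        using A[OF s] fA[OF s] A[OF a] eq[OF s a] by (simp add: t_def m_assoc)
      also have "\<dots> = f a"
        using fA[OF s] fA[OF a] by (simp add: m_assoc[symmetric])
      finally show ?thesis .
    qed
    then show ?thesis
      using left_translation_automorphism[OF assms t] by blast
  qed
qed

section \<open>The characterization\<close>

theorem theorem7p14:
  fixes X :: "('v, 'c) edge_colored"
  assumes "dGEC X" and "verts X \<noteq> {}"
  shows "(absolutely_homogeneous X \<and> distinct_out_colors X
            \<longleftrightarrow> absolutely_homogeneous X \<and> distinct_in_colors X) \<and>
         (absolutely_homogeneous X \<and> distinct_in_colors X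
            \<longleftrightarrow> (\<exists>G :: 'c monoid. group G \<and> isomorphic_dGEC X (left_dGEC G)))"
proof -
  have in_out: "absolutely_homogeneous X \<and> distinct_out_colors X
      \<longleftrightarrow> absolutely_homogeneous X \<and> distinct_in_colors X"
    using distinct_out_imp_in[OF assms(1)] distinct_in_imp_out[OF assms(1)] by blast
  have "\<exists>G :: 'c monoid. group G \<and> isomorphic_dGEC X (left_dGEC G)"
    if X: "absolutely_homogeneous X" "distinct_out_colors X"
  proof -
    obtain e where e: "e \<in> verts X" using assms(2) by blast
    show ?thesis
      using group_color_group[OF assms(1) X e] dGEC_iso_color_group[OF assms(1) X e]
      unfolding isomorphic_dGEC_def by blast
  qed
  moreover have "absolutely_homogeneous X \<and> distinct_out_colors X"
    if G: "group G" "isomorphic_dGEC X (left_dGEC G)" for G :: "'c monoid"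
  proof -
    obtain f where "dGEC_iso X (left_dGEC G) f" using G(2) unfolding isomorphic_dGEC_def by blast
    then show ?thesis
      using absolutely_homogeneous_iso absolutely_homogeneous_left_dGEC[OF G(1)]
        distinct_out_colors_iso distinct_out_colors_left_dGEC[OF G(1)] by blast
  qed
  ultimately show ?thesis using in_out by blast
qed

end
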